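(* Let $A_0,A_1,\dots,A_{n_u}\in M_n(\mathbb{R})$, let $g\in\mathbb{R}^{n\times d}$ be a constant matrix, and let $N=n+\frac{n(n+1)}{2}$. Consider the biaffine drift $f(x,u)=A_0x+\sum_{i=1}^{n_u}u_iA_ix$, $x\in\mathbb{R}^n$, $u\in\mathbb{R}^{n_u}$, and the family $\mathfrak{f}=\{f(\cdot,u):u\in\mathbb{R}^{n_u}\}$ of vector fields on $\mathbb{R}^n$. Then at every $m\in\mathbb{R}^n$ neither of the two conditions $$\dim\left\{\begin{pmatrix} h(m)\\ Dh(m)+Dh(m)^\top\end{pmatrix}:h\in\mathrm{Lie}(\mathfrak{f})\right\}=N,\qquad \dim\left\{\begin{pmatrix} h(m)\\ Dh(m)+Dh(m)^\top\end{pmatrix}:h\in\mathcal{I}(\mathfrak{f})\right\}=N$$ is satisfied. In particular, if in addition $g=0$, then the statistical linearization, i.e. the family $$\mathfrak{F}_g=\left\{(m,P)\mapsto\begin{pmatrix} f(m,u)\\ D_xf(m,u)P+PD_xf(m,u)^\top+gg^\top\end{pmatrix}:u\in\mathbb{R}^{n_u}\right\}$$ of vector fields on $\mathbb{R}^n\times\mathrm{Sym}^+(n)$, satisfies neither the accessibility rank condition nor the accessibility rank condition in fixed time (at any point).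
   Context: $\mathrm{Sym}(n)$ (resp. $\mathrm{Sym}^+(n)$) is the set of real symmetric (resp. symmetric positive definite) $n\times n$ matrices; $D_xf$ and $Dh$ denote Jacobian matrices. For a family $\mathfrak{f}$ of smooth vector fields, with Lie bracket $[h_1,h_2]=dh_2\cdot h_1-dh_1\cdot h_2$: $\mathrm{Lie}(\mathfrak{f})=\mathrm{span}\{[h_1,[\dots,[h_{k-1},h_k]\dots]]:k\ge1,\ h_i\in\mathfrak{f}\}$; $\mathcal{D}(\mathfrak{f})=\{[h_1,[\dots,[h_{k-1},h_k]\dots]]:k\ge2,\ h_i\in\mathfrak{f}\}$; zero-time ideal $\mathcal{I}(\mathfrak{f})=\mathrm{span}\{h_1-h_2,\ h_3:h_1,h_2\in\mathfrak{f},\ h_3\in\mathcal{D}(\mathfrak{f})\}$. The same definitions apply to $\mathfrak{F}_g$. $\mathfrak{F}_g$ satisfies the accessibility rank condition (resp. in fixed time) at $X=(m,P)$ if $\{F(X):F\in\mathrm{Lie}(\mathfrak{F}_g)\}$ (resp. $\{F(X):F\in\mathcal{I}(\mathfrak{F}_g)\}$), a subspace of $\mathbb{R}^n\times\mathrm{Sym}(n)$, has dimension $N$. *)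

theory Defs
  imports "HOL-Analysis.Analysis" "HOL-Library.Function_Algebras"
begin

text \<open>Vector fields form a real vector space pointwise; this makes \<open>span\<close> and \<open>-\<close> available for them.\<close>

instantiation "fun" :: (type, real_vector) real_vector
begin

definition scaleR_fun :: "real \<Rightarrow> ('a \<Rightarrow> 'b) \<Rightarrow> 'a \<Rightarrow> 'b" where
  "scaleR_fun c h = (\<lambda>x. c *\<^sub>R h x)"

instance
  by standard (simp_all add: scaleR_fun_def plus_fun_def fun_eq_iff scaleR_add_right scaleR_add_left)

end

text \<open>A vector field on a state space \<open>S\<close> (an open subset of a linear subspace \<open>V\<close> of the ambient space,
  with values in \<open>V\<close>) is represented by a function on the ambient type of which only the values on
  \<open>S\<close> matter. Derivatives are therefore taken within \<open>S\<close>; when \<open>V\<close> is a proper subspace, the derivative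
  within \<open>S\<close> is unique only on \<open>V\<close>, but in the bracket it is applied to vectors of \<open>V\<close> only.\<close>

definition lie_bracket ::
  "'a set \<Rightarrow> ('a \<Rightarrow> 'a) \<Rightarrow> ('a \<Rightarrow> 'a) \<Rightarrow> 'a \<Rightarrow> 'a::real_normed_vector" where
  "lie_bracket S h1 h2 = (\<lambda>x. frechet_derivative h2 (at x within S) (h1 x)
                              - frechet_derivative h1 (at x within S) (h2 x))"

text \<open>\<open>nested_bracket S FF k h\<close> holds iff \<open>h = [h\<^sub>1, [..., [h\<^sub>k\<^sub>-\<^sub>1, h\<^sub>k]...]]\<close> with all \<open>h\<^sub>i\<close> in \<open>FF\<close>.\<close>

inductive nested_bracket ::
  "'a set \<Rightarrow> ('a \<Rightarrow> 'a) set \<Rightarrow> nat \<Rightarrow> ('a \<Rightarrow> 'a::real_normed_vector) \<Rightarrow> bool"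
  for S FF where
  single: "h \<in> FF \<Longrightarrow> nested_bracket S FF 1 h"
| bracket: "h \<in> FF \<Longrightarrow> nested_bracket S FF k h' \<Longrightarrow> nested_bracket S FF (Suc k) (lie_bracket S h h')"

definition Lie :: "'a set \<Rightarrow> ('a \<Rightarrow> 'a) set \<Rightarrow> ('a \<Rightarrow> 'a::real_normed_vector) set" where
  "Lie S FF = span {h. \<exists>k\<ge>1. nested_bracket S FF k h}"

definition derived_brackets ::
  "'a set \<Rightarrow> ('a \<Rightarrow> 'a) set \<Rightarrow> ('a \<Rightarrow> 'a::real_normed_vector) set" where
  "derived_brackets S FF = {h. \<exists>k\<ge>2. nested_bracket S FF k h}"

definition zero_time_ideal ::
  "'a set \<Rightarrow> ('a \<Rightarrow> 'a) set \<Rightarrow> ('a \<Rightarrow> 'a::real_normed_vector) set" where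
  "zero_time_ideal S FF = span ({h1 - h2 | h1 h2. h1 \<in> FF \<and> h2 \<in> FF} \<union> derived_brackets S FF)"

definition Sym_pos :: "(real^'n^'n) set" where
  "Sym_pos = {P. transpose P = P \<and> (\<forall>x. x \<noteq> 0 \<longrightarrow> x \<bullet> (P *v x) > 0)}"

definition state_space :: "((real^'n) \<times> (real^'n^'n)) set" where
  "state_space = UNIV \<times> Sym_pos"

definition accessibility_rank_condition ::
  "((real^'n) \<times> (real^'n^'n) \<Rightarrow> (real^'n) \<times> (real^'n^'n)) set \<Rightarrow> (real^'n) \<times> (real^'n^'n) \<Rightarrow> bool" where
  "accessibility_rank_condition FF X \<longleftrightarrow>
     dim {F X | F. F \<in> Lie state_space FF} = CARD('n) + CARD('n) * (CARD('n) + 1) div 2"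

definition accessibility_rank_condition_fixed_time ::
  "((real^'n) \<times> (real^'n^'n) \<Rightarrow> (real^'n) \<times> (real^'n^'n)) set \<Rightarrow> (real^'n) \<times> (real^'n^'n) \<Rightarrow> bool" where
  "accessibility_rank_condition_fixed_time FF X \<longleftrightarrow>
     dim {F X | F. F \<in> zero_time_ideal state_space FF} = CARD('n) + CARD('n) * (CARD('n) + 1) div 2"

text \<open>The control space of dimension \<open>nu\<close>, with coordinates \<open>u 1, ..., u nu\<close>; \<open>nu = 0\<close> is allowed.\<close>

definition control_space :: "nat \<Rightarrow> (nat \<Rightarrow> real) set" where
  "control_space nu = {1..nu} \<rightarrow>\<^sub>E UNIV"

definition statistical_linearization ::
  "'u set \<Rightarrow> (real^'n \<Rightarrow> 'u \<Rightarrow> real^'n) \<Rightarrow> real^'d^'n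
    \<Rightarrow> ((real^'n) \<times> (real^'n^'n) \<Rightarrow> (real^'n) \<times> (real^'n^'n)) set" where
  "statistical_linearization U f g =
     {(\<lambda>(m, P). (f m u,
                 jacobian (\<lambda>x. f x u) (at m) ** P
                 + P ** transpose (jacobian (\<lambda>x. f x u) (at m))
                 + g ** transpose g)) | u. u \<in> U}"

end

theory Submission
  imports Defs
begin

text \<open>
  Every control value gives a linear field \<open>x \<mapsto> B x\<close>, and linear fields are closed under linear
  combinations and brackets. So each field in the Lie algebra, and hence each one in the zero-time
  ideal, is again \<open>x \<mapsto> B x\<close> for some matrix \<open>B\<close> (lemma \<open>Lie_linear_on\<close>). When \<open>g = 0\<close> the
  statistical linearization of this field is the linear field
  \<open>L\<^sub>B (m, P) = (B m, B P + P B\<^sup>T)\<close>; here \<open>[L\<^sub>B, L\<^sub>C] = L\<^bsub>CB - BC\<^esub>\<close>, so on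
  \<open>\<real>\<^sup>n \<times> Sym\<^sup>+(n)\<close> the fields in the Lie algebra of the linearized family are again of the form
  \<open>L\<^sub>B\<close>. The vectors in the first pair of conditions are values \<open>L\<^sub>B (m, 1)\<close>, so all four
  conditions fail because of one claim: for positive definite \<open>P\<close> the vectors \<open>L\<^sub>B (m, P)\<close> span a
  proper subspace of \<open>\<real>\<^sup>n \<times> Sym(n)\<close>, a space of dimension \<open>n + n(n+1)/2\<close>
  (lemma \<open>dim_moment_field_values\<close>).

  The claim holds because the mean velocity and the covariance velocity of a linear field are not
  independent. Fix \<open>y\<close> with \<open>P y = m\<close>. Then
  \<open>y \<bullet> (B P + P B\<^sup>T) y = 2 y \<bullet> B P y = 2 y \<bullet> B m\<close>, so the functional
  \<open>(v, Q) \<mapsto> 2 y \<bullet> v - y \<bullet> Q y\<close> vanishes on all \<open>L\<^sub>B (m, P)\<close>. If \<open>m \<noteq> 0\<close>, it does not vanish at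
  \<open>(y, 0)\<close>. If \<open>m = 0\<close>, the first component is always \<open>0\<close>.

  The brackets of the linearized family involve derivatives within \<open>\<real>\<^sup>n \<times> Sym\<^sup>+(n)\<close>, a set
  without interior in the space of all pairs. Such derivatives are unique only along directions in which
  one can move inside the set. Since \<open>Sym\<^sup>+(n)\<close> is open in \<open>Sym(n)\<close>, these include the values of
  all fields \<open>L\<^sub>B\<close> on that set (lemma \<open>state_space_move\<close>).
\<close>

section \<open>Lie algebras of families of linear fields\<close>

text \<open>Restricting the function to a segment through \<open>x\<close> reduces the claim to uniqueness of the
  derivative in one real variable.\<close>

lemma has_derivative_within_unique_direction:
  fixes h :: "'a::real_normed_vector \<Rightarrow> 'b::real_normed_vector"
  assumes D1: "(h has_derivative D1) (at x within S)"
    and D2: "(h has_derivative D2) (at x within S)"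
    and e: "e > 0" "\<And>t. \<bar>t\<bar> < e \<Longrightarrow> x + t *\<^sub>R v \<in> S"
  shows "D1 v = D2 v"
proof -
  let ?g = "\<lambda>t::real. x + t *\<^sub>R v"
  let ?I = "{-e<..<e}"
  have sub: "?g ` ?I \<subseteq> S"
    using e(2) by (auto simp: abs_less_iff)
  have g: "(?g has_derivative (\<lambda>t. t *\<^sub>R v)) (at 0 within ?I)"
    by (auto intro!: derivative_eq_intros)
  have "((h \<circ> ?g) has_derivative (D \<circ> (\<lambda>t. t *\<^sub>R v))) (at 0)"
    if "(h has_derivative D) (at x within S)" for D
  proof -
    have "(h has_derivative D) (at (?g 0) within ?g ` ?I)"
      using has_derivative_subset[OF that sub] by simp
    from diff_chain_within[OF g this] show ?thesis
      using e(1) by (simp add: at_within_open[of 0 ?I])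
  qed
  from has_derivative_unique[OF this[OF D1] this[OF D2]]
  have "(D1 \<circ> (\<lambda>t. t *\<^sub>R v)) 1 = (D2 \<circ> (\<lambda>t. t *\<^sub>R v)) 1"
    by simp
  then show ?thesis by simp
qed

text \<open>\<open>L\<close> is one derivative of \<open>h\<close> within \<open>S\<close>. The one selected by \<open>frechet_derivative\<close> may be
  another map, but both agree in the direction \<open>v\<close>.\<close>

lemma frechet_derivative_within_linear_on:
  fixes h :: "'a::real_normed_vector \<Rightarrow> 'b::real_normed_vector"
  assumes L: "bounded_linear L" and h: "\<And>y. y \<in> S \<Longrightarrow> h y = L y" and x: "x \<in> S"
    and e: "e > 0" "\<And>t. \<bar>t\<bar> < e \<Longrightarrow> x + t *\<^sub>R v \<in> S"
  shows "frechet_derivative h (at x within S) v = L v"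
proof -
  have "(L has_derivative L) (at x within S)"
    by (rule bounded_linear_imp_has_derivative[OF L])
  then have D: "(h has_derivative L) (at x within S)"
    using has_derivative_transform[of x S h L L] x h by blast
  then have "(h has_derivative frechet_derivative h (at x within S)) (at x within S)"
    using frechet_derivative_works differentiable_def by blast
  from has_derivative_within_unique_direction[OF this D e] show ?thesis .
qed

lemma lie_bracket_linear_on:
  fixes S :: "'a::real_normed_vector set"
  assumes "bounded_linear L1" "bounded_linear L2"
    and "\<And>y. y \<in> S \<Longrightarrow> h1 y = L1 y" "\<And>y. y \<in> S \<Longrightarrow> h2 y = L2 y" "x \<in> S"
    and "\<exists>e>0. \<forall>t. \<bar>t\<bar> < e \<longrightarrow> x + t *\<^sub>R L1 x \<in> S"
    and "\<exists>e>0. \<forall>t. \<bar>t\<bar> < e \<longrightarrow> x + t *\<^sub>R L2 x \<in> S"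
  shows "lie_bracket S h1 h2 x = L2 (L1 x) - L1 (L2 x)"
proof -
  obtain e1 where e1: "e1 > 0" "\<And>t. \<bar>t\<bar> < e1 \<Longrightarrow> x + t *\<^sub>R L1 x \<in> S"
    using assms(6) by blast
  obtain e2 where e2: "e2 > 0" "\<And>t. \<bar>t\<bar> < e2 \<Longrightarrow> x + t *\<^sub>R L2 x \<in> S"
    using assms(7) by blast
  show ?thesis
    unfolding lie_bracket_def
    using frechet_derivative_within_linear_on[OF assms(2,4,5) e1]
      frechet_derivative_within_linear_on[OF assms(1,3,5) e2] assms(3,4,5)
    by simp
qed

text \<open>By induction on the nesting, a bracket of a generator with a field that is linear on \<open>S\<close> is
  there the commutator of two maps in \<open>K\<close>. Equality is claimed on \<open>S\<close> only: at other points a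
  derivative within \<open>S\<close> need not have anything to do with the linear map.\<close>

lemma Lie_linear_on:
  fixes S :: "'a::real_normed_vector set" and K :: "('a \<Rightarrow> 'a) set"
  assumes K: "subspace K" "\<And>L. L \<in> K \<Longrightarrow> bounded_linear L"
    and comm: "\<And>L1 L2. L1 \<in> K \<Longrightarrow> L2 \<in> K \<Longrightarrow> (\<lambda>x. L2 (L1 x) - L1 (L2 x)) \<in> K"
    and move: "\<And>L x. L \<in> K \<Longrightarrow> x \<in> S \<Longrightarrow> \<exists>e>0. \<forall>t. \<bar>t\<bar> < e \<longrightarrow> x + t *\<^sub>R L x \<in> S"
    and FF: "FF \<subseteq> K" and h: "h \<in> Lie S FF"
  obtains L where "L \<in> K" "\<And>y. y \<in> S \<Longrightarrow> h y = L y"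
proof -
  let ?H = "{h. \<exists>L\<in>K. \<forall>y\<in>S. h y = L y}"
  have nested: "h \<in> ?H" if "nested_bracket S FF k h" for k h
    using that
  proof (induction rule: nested_bracket.induct)
    case (single h)
    then show ?case using FF by blast
  next
    case (bracket h k h')
    then obtain L where L: "L \<in> K" "\<And>y. y \<in> S \<Longrightarrow> h' y = L y" by blast
    have hK: "h \<in> K" using bracket FF by blast
    have "lie_bracket S h h' y = L (h y) - h (L y)" if "y \<in> S" for y
      by (rule lie_bracket_linear_on) (use K hK L that move in auto)
    then show ?case by (intro CollectI bexI[OF _ comm[OF hK L(1)]]) simp
  qed
  have "subspace ?H"
  proof (rule subspaceI)
    show "0 \<in> ?H"
      by (intro CollectI bexI[OF _ subspace_0[OF K(1)]]) simp
  next
    fix h1 h2 assume "h1 \<in> ?H" "h2 \<in> ?H"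
    then obtain L1 L2 where L: "L1 \<in> K" "L2 \<in> K"
      and "\<forall>y\<in>S. h1 y = L1 y" "\<forall>y\<in>S. h2 y = L2 y"
      by blast
    then show "h1 + h2 \<in> ?H"
      by (intro CollectI bexI[OF _ subspace_add[OF K(1) L]]) simp
  next
    fix c h assume "h \<in> ?H"
    then obtain L where L: "L \<in> K" and "\<forall>y\<in>S. h y = L y"
      by blast
    then show "c *\<^sub>R h \<in> ?H"
      by (intro CollectI bexI[OF _ subspace_scale[OF K(1) L, of c]]) (simp add: scaleR_fun_def)
  qed
  then have "Lie S FF \<subseteq> ?H"
    unfolding Lie_def using nested by (intro span_minimal) auto
  then show thesis using h that by blast
qed

lemma zero_time_ideal_subset_Lie: "zero_time_ideal S FF \<subseteq> Lie S FF"
  unfolding zero_time_ideal_def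
proof (rule span_minimal)
  let ?G = "{h. \<exists>k\<ge>1. nested_bracket S FF k h}"
  have FF: "FF \<subseteq> Lie S FF"
    unfolding Lie_def by (auto intro!: span_base exI[of _ 1] dest: nested_bracket.single)
  have "derived_brackets S FF \<subseteq> ?G"
  proof
    fix h assume "h \<in> derived_brackets S FF"
    then obtain k where "2 \<le> k" "nested_bracket S FF k h"
      unfolding derived_brackets_def by blast
    then show "h \<in> ?G" by (auto intro!: exI[of _ k])
  qed
  then have "derived_brackets S FF \<subseteq> Lie S FF"
    unfolding Lie_def using span_superset by blast
  moreover have "h1 - h2 \<in> Lie S FF" if "h1 \<in> FF" "h2 \<in> FF" for h1 h2
    using FF that unfolding Lie_def by (blast intro: span_diff)
  ultimately show "{h1 - h2 |h1 h2. h1 \<in> FF \<and> h2 \<in> FF} \<union> derived_brackets S FF \<subseteq> Lie S FF"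
    by blast
  show "subspace (Lie S FF)"
    unfolding Lie_def by (rule subspace_span)
qed

section \<open>Linear fields and their action on mean and covariance\<close>

lemma matrix_add_rdistrib: "(A + B) ** C = A ** C + B ** (C::real^'n^'m)"
  by (simp add: matrix_matrix_mult_def vec_eq_iff sum.distrib distrib_right)

lemma matrix_diff_ldistrib: "A ** (B - C) = A ** B - A ** (C::real^'n^'m)"
  by (simp add: matrix_matrix_mult_def vec_eq_iff sum_subtractf right_diff_distrib)

lemma matrix_diff_rdistrib: "(A - B) ** C = A ** C - B ** (C::real^'n^'m)"
  by (simp add: matrix_matrix_mult_def vec_eq_iff sum_subtractf left_diff_distrib)

lemma matrix_scaleR_left: "(k *\<^sub>R A) ** B = k *\<^sub>R (A ** (B::real^'n^'m))"
  by (simp add: scalar_matrix_assoc)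

lemma matrix_scaleR_right: "A ** (k *\<^sub>R B) = k *\<^sub>R (A ** (B::real^'n^'m))"
  by (simp add: scalar_matrix_assoc matrix_scalar_ac)

lemma bounded_linear_matrix_mult_left: "bounded_linear (\<lambda>P::real^'n^'m. (B::real^'m^'k) ** P)"
  by (intro linear_conv_bounded_linear[THEN iffD1] linearI)
    (simp_all add: matrix_add_ldistrib matrix_scaleR_right)

lemma bounded_linear_matrix_mult_right: "bounded_linear (\<lambda>P::real^'n^'m. P ** (B::real^'k^'n))"
  by (intro linear_conv_bounded_linear[THEN iffD1] linearI)
    (simp_all add: matrix_add_rdistrib matrix_scaleR_left)

lemma transpose_add: "transpose (A + B) = transpose A + transpose (B::real^'n^'m)"
  by (simp add: transpose_def vec_eq_iff)

lemma transpose_diff: "transpose (A - B) = transpose A - transpose (B::real^'n^'m)"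
  by (simp add: transpose_def vec_eq_iff)

text \<open>The velocity of mean and covariance when a random vector moves along \<open>x \<mapsto> B x\<close>; equivalently,
  the statistical linearization of that field without noise.\<close>

definition moment_field :: "real^'n^'n \<Rightarrow> (real^'n) \<times> (real^'n^'n) \<Rightarrow> (real^'n) \<times> (real^'n^'n)" where
  "moment_field B = (\<lambda>(m, P). (B *v m, B ** P + P ** transpose B))"

lemma bounded_linear_moment_field: "bounded_linear (moment_field B)"
proof -
  have "bounded_linear (\<lambda>X. (B *v fst X, B ** snd X + snd X ** transpose B))"
    by (intro bounded_linear_Pair bounded_linear_add
        bounded_linear_compose[OF matrix_vector_mul_bounded_linear]
        bounded_linear_compose[OF bounded_linear_matrix_mult_left]
        bounded_linear_compose[OF bounded_linear_matrix_mult_right]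
        bounded_linear_fst bounded_linear_snd)
  then show ?thesis by (simp add: moment_field_def case_prod_unfold)
qed

text \<open>The covariance part of the left-hand side contains \<open>C P B\<^sup>T + B P C\<^sup>T\<close> twice, with opposite
  signs, and what remains is the action of the commutator.\<close>

lemma moment_field_commutator:
  "moment_field C (moment_field B X) - moment_field B (moment_field C X)
     = moment_field (C ** B - B ** C) X"
proof (cases X)
  case (Pair m P)
  show ?thesis
    unfolding Pair
    by (simp add: moment_field_def matrix_vector_mul_assoc matrix_vector_mult_diff_rdistrib
        matrix_add_ldistrib matrix_add_rdistrib matrix_diff_ldistrib matrix_diff_rdistrib
        transpose_diff matrix_transpose_mul matrix_mul_assoc)
qed

lemma linear_moment_field: "linear moment_field"
  by (intro linearI ext; simp add: moment_field_def scaleR_fun_def case_prod_unfold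
      matrix_vector_mult_add_rdistrib matrix_add_ldistrib matrix_add_rdistrib transpose_add
      transpose_scalar matrix_scaleR_left matrix_scaleR_right scaleR_add_right
      flip: scaleR_matrix_vector_assoc)

lemma linear_matrix_vector_field: "linear (\<lambda>B::real^'n^'n. (*v) B)"
  by (intro linearI ext; simp add: scaleR_fun_def matrix_vector_mult_add_rdistrib
      flip: scaleR_matrix_vector_assoc)

section \<open>The positive definite cone\<close>

text \<open>Compactness of the unit sphere gives a uniform lower bound on \<open>x \<bullet> P x\<close>, which a small
  multiple of \<open>Q\<close> cannot destroy.\<close>

lemma Sym_pos_move:
  fixes P Q :: "real^'n^'n"
  assumes P: "P \<in> Sym_pos" and Q: "transpose Q = Q"
  shows "\<exists>e>0. \<forall>t. \<bar>t\<bar> < e \<longrightarrow> P + t *\<^sub>R Q \<in> Sym_pos"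
proof -
  let ?S = "sphere (0::real^'n) 1"
  have "compact ?S" "?S \<noteq> {}"
    by auto
  moreover have cont: "continuous_on ?S (\<lambda>x. x \<bullet> (R *v x))" for R :: "real^'n^'n"
    by (intro continuous_intros linear_continuous_on matrix_vector_mul_bounded_linear)
  ultimately obtain a where a: "a \<in> ?S" "\<And>x. x \<in> ?S \<Longrightarrow> a \<bullet> (P *v a) \<le> x \<bullet> (P *v x)"
    using continuous_attains_inf[of ?S "\<lambda>x. x \<bullet> (P *v x)"] by blast
  define c where "c = a \<bullet> (P *v a)"
  have c: "c > 0"
  proof -
    have "a \<noteq> 0" using a(1) by auto
    then show ?thesis using P by (simp add: Sym_pos_def c_def)
  qed
  obtain K where K: "K > 0" "\<And>x. norm (Q *v x) \<le> norm x * K"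
    using bounded_linear.pos_bounded[OF matrix_vector_mul_bounded_linear[of Q]] by auto
  have "P + t *\<^sub>R Q \<in> Sym_pos" if t: "\<bar>t\<bar> < c / K" for t
  proof -
    have "x \<bullet> ((P + t *\<^sub>R Q) *v x) > 0" if "x \<noteq> 0" for x
    proof -
      define z where "z = x /\<^sub>R norm x"
      have z: "z \<in> ?S" "norm z = 1" "x = norm x *\<^sub>R z"
        using that by (auto simp: z_def)
      have "\<bar>z \<bullet> (Q *v z)\<bar> \<le> K"
        using Cauchy_Schwarz_ineq2[of z "Q *v z"] K(2)[of z] z(2) by simp
      then have "\<bar>t * (z \<bullet> (Q *v z))\<bar> \<le> \<bar>t\<bar> * K"
        by (simp add: abs_mult mult_left_mono)
      also have "\<dots> < c"
        using t K(1) by (simp add: field_simps)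
      finally have "z \<bullet> (P *v z) + t * (z \<bullet> (Q *v z)) > 0"
        using a(2)[OF z(1)] unfolding c_def by linarith
      then have "norm x * (norm x * (z \<bullet> (P *v z) + t * (z \<bullet> (Q *v z)))) > 0"
        using that by simp
      moreover have "x \<bullet> ((P + t *\<^sub>R Q) *v x)
          = norm x * (norm x * (z \<bullet> (P *v z) + t * (z \<bullet> (Q *v z))))"
        by (subst (1 2) z(3))
          (simp add: matrix_vector_mult_add_rdistrib inner_add_right matrix_vector_mult_scaleR distrib_left
            flip: scaleR_matrix_vector_assoc)
      ultimately show ?thesis by simp
    qed
    moreover have "transpose (P + t *\<^sub>R Q) = P + t *\<^sub>R Q"
      using P Q by (simp add: Sym_pos_def transpose_add transpose_scalar)
    ultimately show ?thesis by (simp add: Sym_pos_def)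
  qed
  then show ?thesis
    using c K(1) by (intro exI[of _ "c / K"]) auto
qed

lemma transpose_moment_field:
  "transpose P = P \<Longrightarrow> transpose (snd (moment_field B (m, P))) = snd (moment_field B (m, P))"
  by (simp add: moment_field_def transpose_add matrix_transpose_mul add.commute)

text \<open>The mean is unrestricted, and \<open>B P + P B\<^sup>T\<close> is symmetric, so the covariance moves in a
  direction in which \<open>Sym_pos\<close> is open.\<close>

lemma state_space_move:
  assumes "X \<in> state_space"
  shows "\<exists>e>0. \<forall>t. \<bar>t\<bar> < e \<longrightarrow> X + t *\<^sub>R moment_field B X \<in> state_space"
proof (cases X)
  case (Pair m P)
  then have P: "P \<in> Sym_pos"
    using assms by (simp add: state_space_def)
  then have "transpose (snd (moment_field B (m, P))) = snd (moment_field B (m, P))"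
    by (intro transpose_moment_field) (simp add: Sym_pos_def)
  from Sym_pos_move[OF P this] show ?thesis
    unfolding Pair by (simp add: state_space_def mem_Times_iff)
qed

lemma Sym_pos_surj:
  fixes P :: "real^'n^'n"
  assumes "P \<in> Sym_pos"
  obtains y where "P *v y = m"
proof -
  have "x = 0" if "P *v x = 0" for x
    using assms that by (force simp: Sym_pos_def)
  then have "inj ((*v) P)"
    by (simp add: linear_injective_0)
  then have "surj ((*v) P)"
    by (simp add: linear_injective_imp_surjective)
  then show thesis
    using that by (metis surjD)
qed

lemma mat_1_Sym_pos: "mat 1 \<in> Sym_pos"
  by (simp add: Sym_pos_def transpose_mat)

section \<open>Counting dimensions\<close>

text \<open>Symmetric matrices are functions of the unordered index pair \<open>{i, j}\<close>, so they are spanned by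
  one matrix for each nonempty set of at most two indices. Index sets avoid choosing an order on
  the index type.\<close>

lemma dim_symmetric_le:
  "dim {Q::real^'n^'n. transpose Q = Q} \<le> CARD('n) * (CARD('n) + 1) div 2"
proof -
  let ?T1 = "{T::'n set. T \<subseteq> UNIV \<and> card T = 1}"
  let ?T2 = "{T::'n set. T \<subseteq> UNIV \<and> card T = 2}"
  let ?T = "?T1 \<union> ?T2"
  let ?M = "\<lambda>T::'n set. (\<chi> i j. if T = {i, j} then 1 else 0) :: real^'n^'n"
  have "card ?T \<le> card ?T1 + card ?T2"
    by (rule card_Un_le)
  also have "\<dots> = CARD('n) + (CARD('n) choose 2)"
    using n_subsets[of "UNIV::'n set" 1] n_subsets[of "UNIV::'n set" 2] by simp
  also have "\<dots> = CARD('n) * (CARD('n) + 1) div 2"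
  proof -
    have "even (CARD('n) * (CARD('n) - 1))"
      by simp
    then have "2 * (CARD('n) + (CARD('n) choose 2)) = CARD('n) * (CARD('n) + 1)"
      by (cases "CARD('n)") (simp_all add: choose_two algebra_simps)
    then show ?thesis by (metis nonzero_mult_div_cancel_left zero_neq_numeral)
  qed
  finally have card: "card ?T \<le> CARD('n) * (CARD('n) + 1) div 2" .
  have "{Q. transpose Q = Q} \<subseteq> span (?M ` ?T)"
  proof
    fix Q :: "real^'n^'n" assume "Q \<in> {Q. transpose Q = Q}"
    then have Q: "transpose Q = Q" by simp
    have sym: "Q $ i $ j = Q $ j $ i" for i j
      using arg_cong[OF Q, of "\<lambda>R. R $ j $ i"] by (simp add: transpose_def)
    \<comment> \<open>The coefficient of the index set \<open>{i, j}\<close> is well defined because \<open>Q\<close> is symmetric.\<close>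
    define c where "c T = (THE s. \<exists>i j. T = {i, j} \<and> s = Q $ i $ j)" for T
    have c: "c {i, j} = Q $ i $ j" for i j
      unfolding c_def by (rule the_equality) (auto simp: doubleton_eq_iff sym)
    have mem: "{i, j} \<in> ?T" for i j
      by (simp add: card_insert_if)
    have "Q = (\<Sum>T\<in>?T. c T *\<^sub>R ?M T)"
    proof (simp only: vec_eq_iff, intro allI)
      fix i j
      have "(\<Sum>T\<in>?T. c T *\<^sub>R ?M T) $ i $ j = (\<Sum>T\<in>?T. if T = {i, j} then c T else 0)"
        by (simp add: if_distrib cong: if_cong)
      also have "\<dots> = Q $ i $ j"
        using mem[of i j] by (subst sum.delta) (simp_all add: c)
      finally show "Q $ i $ j = (\<Sum>T\<in>?T. c T *\<^sub>R ?M T) $ i $ j" by simp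
    qed
    moreover have "(\<Sum>T\<in>?T. c T *\<^sub>R ?M T) \<in> span (?M ` ?T)"
      by (intro span_sum span_scale span_base) auto
    ultimately show "Q \<in> span (?M ` ?T)" by simp
  qed
  then have "dim {Q::real^'n^'n. transpose Q = Q} \<le> card (?M ` ?T)"
    by (intro dim_le_card) auto
  also have "\<dots> \<le> card ?T"
    by (intro card_image_le) simp
  finally show ?thesis using card by linarith
qed

text \<open>The linear relation between the two components of \<open>L\<^sub>B (m, P)\<close>: both sides equal
  \<open>2 y \<bullet> B P y\<close>, and \<open>y\<close> depends on \<open>m\<close> and \<open>P\<close> only.\<close>

lemma inner_moment_field:
  fixes P B :: "real^'n^'n"
  assumes "transpose P = P" "P *v y = m"
  shows "y \<bullet> (snd (moment_field B (m, P)) *v y) = 2 * (y \<bullet> fst (moment_field B (m, P)))"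
proof -
  have BP: "(B ** P) *v y = B *v m"
    using assms(2) by (simp flip: matrix_vector_mul_assoc)
  have "y \<bullet> ((P ** transpose B) *v y) = y \<bullet> (transpose (B ** P) *v y)"
    using assms(1) by (simp add: matrix_transpose_mul)
  also have "\<dots> = y \<bullet> ((B ** P) *v y)"
    by (metis dot_lmul_matrix inner_commute transpose_matrix_vector)
  finally show ?thesis
    using BP by (simp add: moment_field_def matrix_vector_mult_add_rdistrib inner_add_right)
qed

text \<open>All values lie in the subspace \<open>U\<close> of \<open>\<real>\<^sup>n \<times> Sym(n)\<close> cut out by the relation of
  \<open>inner_moment_field\<close>. For \<open>m = 0\<close> that relation is trivial, as then \<open>y = 0\<close>, so in this case
  the definition of \<open>U\<close> also asks for a vanishing first component.\<close>

lemma dim_moment_field_values: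
  fixes P :: "real^'n^'n"
  assumes P: "P \<in> Sym_pos"
    and W: "W \<subseteq> range (\<lambda>B. moment_field B (m, P))"
  shows "dim W < CARD('n) + CARD('n) * (CARD('n) + 1) div 2"
proof -
  let ?Sym = "{Q::real^'n^'n. transpose Q = Q}"
  let ?V = "(UNIV::(real^'n) set) \<times> ?Sym"
  have symP: "transpose P = P"
    using P by (simp add: Sym_pos_def)
  have sub: "subspace ?Sym"
    by (rule subspaceI)
      (auto simp: transpose_add transpose_scalar transpose_def vec_eq_iff)
  then have V: "subspace ?V"
    by (simp add: subspace_Times)
  have "dim ?V = CARD('n) + dim ?Sym"
    by (simp add: dim_Times sub)
  then have dimV: "dim ?V \<le> CARD('n) + CARD('n) * (CARD('n) + 1) div 2"
    using dim_symmetric_le[where 'n='n] by simp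
  obtain y where y: "P *v y = m"
    using Sym_pos_surj[OF P] .
  let ?U = "{X \<in> ?V. (m = 0 \<longrightarrow> fst X = 0) \<and> y \<bullet> (snd X *v y) = 2 * (y \<bullet> fst X)}"
  have "W \<subseteq> ?U"
  proof
    fix X assume "X \<in> W"
    then obtain B where "X = moment_field B (m, P)"
      using W by blast
    then show "X \<in> ?U"
      using inner_moment_field[OF symP y, of B] transpose_moment_field[OF symP, of B m]
      by (auto simp: moment_field_def mem_Times_iff)
  qed
  moreover have subU: "subspace ?U"
  proof (rule subspaceI)
    show "0 \<in> ?U"
      using subspace_0[OF V] by simp
  next
    fix X Y assume "X \<in> ?U" "Y \<in> ?U"
    then show "X + Y \<in> ?U"
      using subspace_add[OF V, of X Y]
      by (simp add: matrix_vector_mult_add_rdistrib inner_add_right)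
  next
    fix c X assume "X \<in> ?U"
    then show "c *\<^sub>R X \<in> ?U"
      using subspace_scale[OF V, of X c]
      by (simp flip: scaleR_matrix_vector_assoc)
  qed
  moreover have "?U \<noteq> ?V"
  proof (cases "m = 0")
    case True
    then have "(1, 0) \<notin> ?U" by simp
    moreover have "(1, 0) \<in> ?V" using subspace_0[OF sub] by simp
    ultimately show ?thesis by blast
  next
    case False
    then have "y \<noteq> 0" using y by auto
    then have "(y, 0) \<notin> ?U" by simp
    moreover have "(y, 0) \<in> ?V" using subspace_0[OF sub] by simp
    ultimately show ?thesis by blast
  qed
  ultimately have "dim W \<le> dim ?U" "?U \<subset> ?V"
    by (blast intro: dim_subset)+
  moreover from this have "dim ?U < dim ?V"
    by (intro dim_psubset) (simp only: span_eq_iff[THEN iffD2, OF subU] span_eq_iff[THEN iffD2, OF V])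
  ultimately have "dim W < dim ?V" by linarith
  then show ?thesis using dimV by linarith
qed

section \<open>Failure of the rank conditions\<close>

lemma jacobian_matrix_vector: "jacobian ((*v) B) (at m) = (B::real^'n^'n)"
  unfolding jacobian_def
  by (simp flip: frechet_derivative_at[OF bounded_linear_imp_has_derivative[OF
        matrix_vector_mul_bounded_linear]])

text \<open>The pair \<open>(h(m), Dh(m) + Dh(m)\<^sup>T)\<close> is the moment field evaluated at covariance \<open>1\<close>.\<close>

lemma Lie_linear_fields_value:
  fixes ff :: "(real^'n \<Rightarrow> real^'n) set"
  assumes "ff \<subseteq> range (*v)" "h \<in> Lie UNIV ff"
  shows "(h m, jacobian h (at m) + transpose (jacobian h (at m)))
    \<in> range (\<lambda>B. moment_field B (m, mat 1))"
proof -
  have sub: "subspace (range ((*v) :: real^'n^'n \<Rightarrow> _))"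
    using linear_subspace_image[OF linear_matrix_vector_field subspace_UNIV] .
  have comm: "(\<lambda>x. C *v (B *v x) - B *v (C *v x)) \<in> range (*v)" for B C :: "real^'n^'n"
    by (rule range_eqI[of _ _ "C ** B - B ** C"])
      (simp add: fun_eq_iff matrix_vector_mul_assoc matrix_vector_mult_diff_rdistrib)
  obtain L where "L \<in> range (*v)" "\<And>y. h y = L y"
  proof (rule Lie_linear_on[OF sub _ _ _ assms])
    show "\<exists>e>0. \<forall>t. \<bar>t\<bar> < e \<longrightarrow> x + t *\<^sub>R L x \<in> UNIV" for L and x :: "real^'n"
      by (auto intro: zero_less_one)
  qed (use comm in auto)
  then obtain B where "h = (*v) B"
    by (auto simp: fun_eq_iff)
  then show ?thesis
    by (auto simp: jacobian_matrix_vector moment_field_def)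
qed

lemma Lie_moment_fields_value:
  assumes "FF \<subseteq> range moment_field" "F \<in> Lie state_space FF" "X \<in> state_space"
  shows "F X \<in> range (\<lambda>B. moment_field B X)"
proof -
  have sub: "subspace (range (moment_field :: real^'n^'n \<Rightarrow> _))"
    using linear_subspace_image[OF linear_moment_field subspace_UNIV] .
  obtain L where "L \<in> range moment_field" "\<And>Y. Y \<in> state_space \<Longrightarrow> F Y = L Y"
    by (rule Lie_linear_on[OF sub _ _ _ assms(1,2)])
      (auto simp: bounded_linear_moment_field moment_field_commutator state_space_move)
  then show ?thesis
    using assms(3) by auto
qed

theorem proposition2p15:
  fixes A :: "nat \<Rightarrow> real^'n^'n" and nu :: nat and g :: "real^'d^'n" and N :: nat
    and f :: "real^'n \<Rightarrow> (nat \<Rightarrow> real) \<Rightarrow> real^'n"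
    and ff :: "(real^'n \<Rightarrow> real^'n) set"
  assumes "N = CARD('n) + CARD('n) * (CARD('n) + 1) div 2"
    and "f = (\<lambda>x u. A 0 *v x + (\<Sum>i=1..nu. u i *\<^sub>R (A i *v x)))"
    and "ff = {(\<lambda>x. f x u) | u. u \<in> control_space nu}"
  shows "(\<forall>m :: real^'n.
            dim {(h m, jacobian h (at m) + transpose (jacobian h (at m))) | h.
                   h \<in> Lie UNIV ff} \<noteq> N \<and>
            dim {(h m, jacobian h (at m) + transpose (jacobian h (at m))) | h.
                   h \<in> zero_time_ideal UNIV ff} \<noteq> N) \<and>
         (g = 0 \<longrightarrow>
           (\<forall>X \<in> state_space.
              \<not> accessibility_rank_condition
                   (statistical_linearization (control_space nu) f g) X \<and>
              \<not> accessibility_rank_condition_fixed_time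
                   (statistical_linearization (control_space nu) f g) X))"
proof -
  define B where "B u = A 0 + (\<Sum>i=1..nu. u i *\<^sub>R A i)" for u :: "nat \<Rightarrow> real"
  let ?FF = "statistical_linearization (control_space nu) f g"
  have sum: "(\<Sum>i\<in>I. M i) *v x = (\<Sum>i\<in>I. M i *v x)" for M :: "nat \<Rightarrow> real^'n^'n" and I x
  proof -
    have "linear (\<lambda>B. B *v x)"
      by (intro linearI) (simp_all add: matrix_vector_mult_add_rdistrib
          flip: scaleR_matrix_vector_assoc)
    from linear_sum[OF this] show ?thesis .
  qed
  have f: "f x u = B u *v x" for x u
    unfolding assms(2) B_def
    by (simp add: matrix_vector_mult_add_rdistrib sum flip: scaleR_matrix_vector_assoc)
  then have ff: "ff \<subseteq> range (*v)"
    unfolding assms(3) f by auto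
  show ?thesis
  proof (intro conjI allI impI ballI)
    fix m
    have "dim {(h m, jacobian h (at m) + transpose (jacobian h (at m))) | h. h \<in> H} < N"
      if "H \<subseteq> Lie UNIV ff" for H
      unfolding assms(1)
      using that Lie_linear_fields_value[OF ff, of _ m]
      by (intro dim_moment_field_values[OF mat_1_Sym_pos, of _ m]) auto
    from this[OF order_refl] this[OF zero_time_ideal_subset_Lie]
    show "dim {(h m, jacobian h (at m) + transpose (jacobian h (at m))) | h.
             h \<in> Lie UNIV ff} \<noteq> N"
      "dim {(h m, jacobian h (at m) + transpose (jacobian h (at m))) | h.
             h \<in> zero_time_ideal UNIV ff} \<noteq> N"
      by simp_all
  next
    fix X :: "(real^'n) \<times> (real^'n^'n)"
    assume g: "g = 0" and X: "X \<in> state_space"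
    obtain m P where mP: "X = (m, P)" "P \<in> Sym_pos"
      using X by (auto simp: state_space_def)
    have "(\<lambda>(m, P). (f m u, jacobian (\<lambda>x. f x u) (at m) ** P
            + P ** transpose (jacobian (\<lambda>x. f x u) (at m)) + g ** transpose g))
          = moment_field (B u)" for u
      by (simp add: moment_field_def f jacobian_matrix_vector g)
    then have FF: "?FF \<subseteq> range moment_field"
      unfolding statistical_linearization_def by auto
    have "dim {F X | F. F \<in> H} < CARD('n) + CARD('n) * (CARD('n) + 1) div 2"
      if "H \<subseteq> Lie state_space ?FF" for H
      using that Lie_moment_fields_value[OF FF _ X]
      by (intro dim_moment_field_values[OF mP(2), of _ m]) (auto simp: mP(1))
    from this[OF order_refl] this[OF zero_time_ideal_subset_Lie]
    show "\<not> accessibility_rank_condition ?FF X"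
      "\<not> accessibility_rank_condition_fixed_time ?FF X"
      unfolding accessibility_rank_condition_def accessibility_rank_condition_fixed_time_def
      by simp_all
  qed
qed

end
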